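(* Let $R$ be a finite commutative Frobenius ring with generating character $\varepsilon:(R,+)\to\mathbb{C}^\times$, let $V=R^k$ with a perfect $R$-bilinear form $\beta:V\times V\to R$, let $n\ge 1$, and let $A,B\subseteq V^{\oplus n}$ be $R$-submodules. The subgroup $$S_{A,B}:=\langle T_a: a\in A\rangle\cdot\langle M_b: b\in B\rangle$$ of the group generated by all shift and phase operators on $\mathrm{Fun}(V^{\oplus n},\mathbb{C})$ is abelian if and only if $\varepsilon(\beta(b,a))=1$ for all $a\in A$, $b\in B$; equivalently, if and only if $B\subseteq A^\perp$ with respect to the Frobenius phase pairing.
   Context: A finite commutative ring $R$ is Frobenius with generating character $\varepsilon$ if $\varepsilon:(R,+)\to\mathbb{C}^\times$ is a character such that $x\mapsto(y\mapsto\varepsilon(xy))$ is an isomorphism $R\to\widehat R$ of $R$-modules, where $\widehat R$ is the group of additive characters of $R$. A bilinear form $\beta:V\times V\to R$ is perfect if the induced maps $V\to\mathrm{Hom}_R(V,R)$ are isomorphisms. The form $\beta$ is extended to $V^{\oplus n}$ by $\beta(x,y)=\sum_{i=1}^n\beta(x_i,y_i)$. The Frobenius phase pairing is $\langle x,y\rangle=\varepsilon(\beta(x,y))$, and $A^\perp=\{x\in V^{\oplus n}:\langle x,a\rangle=1\text{ for all }a\in A\}$. $\mathrm{Fun}(V^{\oplus n},\mathbb{C})$ is the space of functions $V^{\oplus n}\to\mathbb{C}$; for $a,b\in V^{\oplus n}$, $(T_af)(x)=f(x-a)$ and $(M_bf)(x)=\varepsilon(\beta(b,x))f(x)$. For $A,B$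 not satisfying the condition, $S_{A,B}$ is understood as the subgroup generated by all $T_a$ ($a\in A$) and $M_b$ ($b\in B$). *)

theory Defs
  imports Complex_Main "HOL-Algebra.Module" "HOL-Algebra.Bij" "HOL-Algebra.Generated_Groups"
begin

section \<open>Modules over a ring\<close>

text \<open>
  The record fields \<open>mult\<close> and \<open>one\<close> that a module inherits from \<open>ring\<close> carry no meaning
  and are left undefined. Functions are extensional throughout, so that equality of
  elements is equality of functions on the intended domain.
\<close>

definition self_module :: "('r, 'm) ring_scheme \<Rightarrow> ('r, 'r) module" where
  "self_module R = \<lparr>carrier = carrier R, mult = undefined, one = undefined,
     zero = \<zero>\<^bsub>R\<^esub>, add = (\<lambda>x y. x \<oplus>\<^bsub>R\<^esub> y), smult = (\<lambda>r x. r \<otimes>\<^bsub>R\<^esub> x)\<rparr>"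

definition direct_power :: "('r, 'v, 'm) module_scheme \<Rightarrow> nat \<Rightarrow> ('r, nat \<Rightarrow> 'v) module" where
  "direct_power M n = \<lparr>carrier = {..<n} \<rightarrow>\<^sub>E carrier M, mult = undefined, one = undefined,
     zero = (\<lambda>i\<in>{..<n}. \<zero>\<^bsub>M\<^esub>),
     add = (\<lambda>x y. \<lambda>i\<in>{..<n}. x i \<oplus>\<^bsub>M\<^esub> y i),
     smult = (\<lambda>r x. \<lambda>i\<in>{..<n}. r \<odot>\<^bsub>M\<^esub> x i)\<rparr>"

definition free_module :: "('r, 'm) ring_scheme \<Rightarrow> nat \<Rightarrow> ('r, nat \<Rightarrow> 'r) module" where
  "free_module R k = direct_power (self_module R) k"

definition mod_hom ::
  "('r, 'k) ring_scheme \<Rightarrow> ('r, 'v, 'm) module_scheme \<Rightarrow> ('r, 'w, 'n) module_scheme \<Rightarrow> ('v \<Rightarrow> 'w) set"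
where
  "mod_hom R M N = {f \<in> hom (add_monoid M) (add_monoid N) \<inter> extensional (carrier M).
     \<forall>r\<in>carrier R. \<forall>x\<in>carrier M. f (r \<odot>\<^bsub>M\<^esub> x) = r \<odot>\<^bsub>N\<^esub> f x}"

definition mod_iso ::
  "('r, 'k) ring_scheme \<Rightarrow> ('r, 'v, 'm) module_scheme \<Rightarrow> ('r, 'w, 'n) module_scheme \<Rightarrow> ('v \<Rightarrow> 'w) set"
where
  "mod_iso R M N = {f \<in> mod_hom R M N. bij_betw f (carrier M) (carrier N)}"

definition hom_module ::
  "('r, 'k) ring_scheme \<Rightarrow> ('r, 'v, 'm) module_scheme \<Rightarrow> ('r, 'w, 'n) module_scheme
    \<Rightarrow> ('r, 'v \<Rightarrow> 'w) module"
where
  "hom_module R M N = \<lparr>carrier = mod_hom R M N, mult = undefined, one = undefined,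
     zero = (\<lambda>x\<in>carrier M. \<zero>\<^bsub>N\<^esub>),
     add = (\<lambda>f g. \<lambda>x\<in>carrier M. f x \<oplus>\<^bsub>N\<^esub> g x),
     smult = (\<lambda>r f. \<lambda>x\<in>carrier M. r \<odot>\<^bsub>N\<^esub> f x)\<rparr>"


section \<open>Frobenius rings\<close>

definition complex_units :: "complex monoid" where
  "complex_units = \<lparr>carrier = UNIV - {0}, mult = (*), one = 1\<rparr>"

text \<open>
  The group of additive characters, written additively in the record although its operation
  is the pointwise product, with the action \<open>(r \<cdot> \<chi>)(y) = \<chi>(r y)\<close>.
\<close>

definition char_module :: "('r, 'm) ring_scheme \<Rightarrow> ('r, 'r \<Rightarrow> complex) module" where
  "char_module R = \<lparr>carrier = hom (add_monoid R) complex_units \<inter> extensional (carrier R),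
     mult = undefined, one = undefined,
     zero = (\<lambda>y\<in>carrier R. 1),
     add = (\<lambda>\<chi> \<psi>. \<lambda>y\<in>carrier R. \<chi> y * \<psi> y),
     smult = (\<lambda>r \<chi>. \<lambda>y\<in>carrier R. \<chi> (r \<otimes>\<^bsub>R\<^esub> y))\<rparr>"

definition generating_character :: "('r, 'm) ring_scheme \<Rightarrow> ('r \<Rightarrow> complex) \<Rightarrow> bool" where
  "generating_character R \<epsilon> \<longleftrightarrow>
     \<epsilon> \<in> hom (add_monoid R) complex_units \<and>
     (\<lambda>x\<in>carrier R. \<lambda>y\<in>carrier R. \<epsilon> (x \<otimes>\<^bsub>R\<^esub> y)) \<in> mod_iso R (self_module R) (char_module R)"

definition frobenius_ring :: "('r, 'm) ring_scheme \<Rightarrow> ('r \<Rightarrow> complex) \<Rightarrow> bool" where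
  "frobenius_ring R \<epsilon> \<longleftrightarrow> cring R \<and> finite (carrier R) \<and> generating_character R \<epsilon>"


section \<open>Perfect bilinear forms and the phase pairing\<close>

definition bilinear_form ::
  "('r, 'k) ring_scheme \<Rightarrow> ('r, 'v, 'm) module_scheme \<Rightarrow> ('v \<Rightarrow> 'v \<Rightarrow> 'r) \<Rightarrow> bool"
where
  "bilinear_form R V \<beta> \<longleftrightarrow>
     (\<forall>x\<in>carrier V. (\<lambda>y\<in>carrier V. \<beta> x y) \<in> mod_hom R V (self_module R)) \<and>
     (\<forall>y\<in>carrier V. (\<lambda>x\<in>carrier V. \<beta> x y) \<in> mod_hom R V (self_module R))"

definition perfect_form ::
  "('r, 'k) ring_scheme \<Rightarrow> ('r, 'v, 'm) module_scheme \<Rightarrow> ('v \<Rightarrow> 'v \<Rightarrow> 'r) \<Rightarrow> bool"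
where
  "perfect_form R V \<beta> \<longleftrightarrow> bilinear_form R V \<beta> \<and>
     (\<lambda>x\<in>carrier V. \<lambda>y\<in>carrier V. \<beta> x y) \<in> mod_iso R V (hom_module R V (self_module R)) \<and>
     (\<lambda>y\<in>carrier V. \<lambda>x\<in>carrier V. \<beta> x y) \<in> mod_iso R V (hom_module R V (self_module R))"

definition ext_form ::
  "('r, 'm) ring_scheme \<Rightarrow> ('v \<Rightarrow> 'v \<Rightarrow> 'r) \<Rightarrow> nat \<Rightarrow> (nat \<Rightarrow> 'v) \<Rightarrow> (nat \<Rightarrow> 'v) \<Rightarrow> 'r"
where
  "ext_form R \<beta> n x y = (\<Oplus>\<^bsub>R\<^esub>i\<in>{..<n}. \<beta> (x i) (y i))"

definition phase_pairing ::
  "('r, 'm) ring_scheme \<Rightarrow> ('r \<Rightarrow> complex) \<Rightarrow> ('v \<Rightarrow> 'v \<Rightarrow> 'r) \<Rightarrow> nat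
    \<Rightarrow> (nat \<Rightarrow> 'v) \<Rightarrow> (nat \<Rightarrow> 'v) \<Rightarrow> complex"
where
  "phase_pairing R \<epsilon> \<beta> n x y = \<epsilon> (ext_form R \<beta> n x y)"

definition perp :: "('r, 'w, 'm) module_scheme \<Rightarrow> ('w \<Rightarrow> 'w \<Rightarrow> complex) \<Rightarrow> 'w set \<Rightarrow> 'w set" where
  "perp N p A = {x \<in> carrier N. \<forall>a\<in>A. p x a = 1}"


section \<open>Shift and phase operators\<close>

text \<open>
  In what follows, \<open>N\<close> is the module on which functions live and \<open>p\<close> is the phase pairing on it.
\<close>

definition fun_space :: "('r, 'w, 'm) module_scheme \<Rightarrow> ('w \<Rightarrow> complex) set" where
  "fun_space N = carrier N \<rightarrow>\<^sub>E UNIV"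

definition shift_op ::
  "('r, 'w, 'm) module_scheme \<Rightarrow> 'w \<Rightarrow> ('w \<Rightarrow> complex) \<Rightarrow> ('w \<Rightarrow> complex)"
where
  "shift_op N a = (\<lambda>f\<in>fun_space N. \<lambda>x\<in>carrier N. f (x \<ominus>\<^bsub>N\<^esub> a))"

definition phase_op ::
  "('r, 'w, 'm) module_scheme \<Rightarrow> ('w \<Rightarrow> 'w \<Rightarrow> complex) \<Rightarrow> 'w \<Rightarrow> ('w \<Rightarrow> complex) \<Rightarrow> ('w \<Rightarrow> complex)"
where
  "phase_op N p b = (\<lambda>f\<in>fun_space N. \<lambda>x\<in>carrier N. p b x * f x)"

definition operator_group ::
  "('r, 'w, 'm) module_scheme \<Rightarrow> ('w \<Rightarrow> 'w \<Rightarrow> complex) \<Rightarrow> (('w \<Rightarrow> complex) \<Rightarrow> ('w \<Rightarrow> complex)) monoid"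
where
  "operator_group N p = (BijGroup (fun_space N))\<lparr>carrier :=
     generate (BijGroup (fun_space N)) (shift_op N ` carrier N \<union> phase_op N p ` carrier N)\<rparr>"

text \<open>
  The subgroup generated by all \<open>T\<^sub>a\<close> and \<open>M\<^sub>b\<close>. The set product
  \<open>\<langle>T\<^sub>a : a \<in> A\<rangle> \<cdot> \<langle>M\<^sub>b : b \<in> B\<rangle>\<close> is in general only a subset of it; the two agree when
  \<open>\<epsilon>(\<beta>(b,a)) = 1\<close> on \<open>A \<times> B\<close>, see \<open>S_subgroup_eq_product\<close> below.
\<close>

definition S_subgroup ::
  "('r, 'w, 'm) module_scheme \<Rightarrow> ('w \<Rightarrow> 'w \<Rightarrow> complex) \<Rightarrow> 'w set \<Rightarrow> 'w set
    \<Rightarrow> (('w \<Rightarrow> complex) \<Rightarrow> ('w \<Rightarrow> complex)) set"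
where
  "S_subgroup N p A B = generate (operator_group N p) (shift_op N ` A \<union> phase_op N p ` B)"


section \<open>Consistency of the definitions\<close>

lemma module_self:
  assumes "cring R"
  shows "module R (self_module R)"
proof -
  interpret cring R by fact
  show ?thesis
  proof (rule moduleI)
    show "abelian_group (self_module R)"
      by (rule abelian_groupI)
        (auto simp: self_module_def a_ac intro: bexI[of _ "\<ominus>\<^bsub>R\<^esub> _"] l_neg)
  qed (auto simp: self_module_def l_distr r_distr m_assoc assms)
qed

lemma module_direct_power:
  assumes "module R M"
  shows "module R (direct_power M n)"
proof -
  interpret module R M by fact
  show ?thesis
  proof (rule moduleI)
    show "abelian_group (direct_power M n)"
    proof (rule abelian_groupI)
      fix x assume x: "x \<in> carrier (direct_power M n)"
      show "\<exists>y\<in>carrier (direct_power M n).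
          y \<oplus>\<^bsub>direct_power M n\<^esub> x = \<zero>\<^bsub>direct_power M n\<^esub>"
        by (rule bexI[of _ "\<lambda>i\<in>{..<n}. \<ominus>\<^bsub>M\<^esub> x i"])
          (use x in \<open>auto simp: direct_power_def PiE_iff M.l_neg intro!: restrict_ext\<close>)
    qed (auto simp: direct_power_def PiE_iff M.a_ac
        intro!: extensionalityI[of _ "{..<n}"] restrict_ext)
  qed (auto simp: direct_power_def PiE_iff smult_l_distr smult_r_distr smult_assoc1 R.is_cring
      intro!: extensionalityI[of _ "{..<n}"] restrict_ext)
qed

lemma module_free:
  assumes "cring R"
  shows "module R (free_module R k)"
  unfolding free_module_def by (intro module_direct_power module_self assms)

lemma (in group) generate_Un_commuting:
  assumes "X \<subseteq> carrier G" "Y \<subseteq> carrier G"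
    and comm: "\<And>x y. x \<in> X \<Longrightarrow> y \<in> Y \<Longrightarrow> x \<otimes> y = y \<otimes> x"
  shows "generate G (X \<union> Y) = generate G X <#> generate G Y"
proof -
  have gX: "subgroup (generate G X) G" and gY: "subgroup (generate G Y) G"
    using assms by (auto intro: generate_is_subgroup)
  have commX: "x \<otimes> y = y \<otimes> x" if "x \<in> generate G X" "y \<in> Y" for x y
    using that(1)
  proof (induction rule: generate.induct)
    case (inv h)
    then have "h \<in> carrier G" "y \<in> carrier G" "h \<otimes> y = y \<otimes> h"
      using assms that by auto
    then show ?case
      by (metis inv_closed inv_solve_left inv_solve_right m_assoc m_closed)
  next
    case (eng h1 h2)
    have "h1 \<in> carrier G" "h2 \<in> carrier G" "y \<in> carrier G"
      using eng generate_in_carrier assms that by blast+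
    then show ?case using eng by (metis m_assoc)
  qed (use assms that in auto)
  have commXY: "x \<otimes> y = y \<otimes> x" if "x \<in> generate G X" "y \<in> generate G Y" for x y
    using that(2)
  proof (induction rule: generate.induct)
    case (inv h)
    then have "h \<in> carrier G" "x \<in> carrier G" "x \<otimes> h = h \<otimes> x"
      using assms that commX generate_in_carrier[of X x] by auto
    then show ?case
      by (metis inv_closed inv_solve_left inv_solve_right m_assoc m_closed)
  next
    case (eng h1 h2)
    have "h1 \<in> carrier G" "h2 \<in> carrier G" "x \<in> carrier G"
      using eng generate_in_carrier assms that by blast+
    then show ?case using eng by (metis m_assoc)
  qed (use assms that commX generate_in_carrier[of X x] in auto)
  have Xc: "generate G X \<subseteq> carrier G" and Yc: "generate G Y \<subseteq> carrier G"
    using assms by (auto intro: generate_in_carrier)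
  show ?thesis
  proof
    show "generate G X <#> generate G Y \<subseteq> generate G (X \<union> Y)"
      using mono_generate[of X "X \<union> Y"] mono_generate[of Y "X \<union> Y"]
      by (auto simp: set_mult_def intro!: generate.eng)
  next
    show "generate G (X \<union> Y) \<subseteq> generate G X <#> generate G Y"
    proof
      fix z assume "z \<in> generate G (X \<union> Y)"
      then show "z \<in> generate G X <#> generate G Y"
      proof (induction rule: generate.induct)
        case one
        have "\<one> = \<one> \<otimes> \<one>" by simp
        then show ?case unfolding set_mult_def using generate.one by blast
      next
        case (incl h)
        then have "h = h \<otimes> \<one>" "h = \<one> \<otimes> h" using assms by auto
        then show ?case unfolding set_mult_def
          using incl generate.one[of G] generate.incl[of h _ G] by blast
      next
        case (inv h)
        then have "inv h = inv h \<otimes> \<one>" "inv h = \<one> \<otimes> inv h" using assms by auto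
        then show ?case unfolding set_mult_def
          using inv generate.one[of G] generate.inv[of h _ G] by blast
      next
        case (eng h1 h2)
        then obtain x1 y1 x2 y2 where
          h: "h1 = x1 \<otimes> y1" "h2 = x2 \<otimes> y2"
            "x1 \<in> generate G X" "y1 \<in> generate G Y" "x2 \<in> generate G X" "y2 \<in> generate G Y"
          by (auto simp: set_mult_def)
        then have c: "x1 \<in> carrier G" "y1 \<in> carrier G" "x2 \<in> carrier G" "y2 \<in> carrier G"
          using Xc Yc by auto
        have "h1 \<otimes> h2 = x1 \<otimes> (y1 \<otimes> x2) \<otimes> y2"
          using h c by (simp add: m_assoc)
        also have "\<dots> = x1 \<otimes> (x2 \<otimes> y1) \<otimes> y2"
          using commXY[OF h(5,4)] by simp
        also have "\<dots> = (x1 \<otimes> x2) \<otimes> (y1 \<otimes> y2)"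
          using c by (simp add: m_assoc)
        finally show ?case unfolding set_mult_def
          using generate.eng[OF h(3,5)] generate.eng[OF h(4,6)] by blast
      qed
    qed
  qed
qed

lemma phase_pairing_add_right:
  assumes R: "frobenius_ring R \<epsilon>" and \<beta>: "bilinear_form R V \<beta>"
    and V: "module R V" and N: "N = direct_power V n"
    and b: "b \<in> carrier N" and x: "x \<in> carrier N" and y: "y \<in> carrier N"
  shows "phase_pairing R \<epsilon> \<beta> n b (x \<oplus>\<^bsub>N\<^esub> y) = phase_pairing R \<epsilon> \<beta> n b x * phase_pairing R \<epsilon> \<beta> n b y"
    and "phase_pairing R \<epsilon> \<beta> n b x \<noteq> 0"
proof -
  interpret cring R using R by (simp add: frobenius_ring_def)
  have \<epsilon>: "\<epsilon> \<in> hom (add_monoid R) complex_units"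
    using R by (simp add: frobenius_ring_def generating_character_def)
  have mem: "b i \<in> carrier V" "x i \<in> carrier V" "y i \<in> carrier V" if "i < n" for i
    using that b x y by (auto simp: N direct_power_def PiE_iff)
  have B: "(\<lambda>y\<in>carrier V. \<beta> u y) \<in> hom (add_monoid V) (add_monoid (self_module R))"
    if "u \<in> carrier V" for u
    using \<beta> that by (auto simp: bilinear_form_def mod_hom_def)
  have closed: "\<beta> u v \<in> carrier R" if "u \<in> carrier V" "v \<in> carrier V" for u v
    using hom_in_carrier[OF B[OF that(1)], of v] that by (simp add: self_module_def)
  have add: "\<beta> u (v \<oplus>\<^bsub>V\<^esub> w) = \<beta> u v \<oplus>\<^bsub>R\<^esub> \<beta> u w"
    if "u \<in> carrier V" "v \<in> carrier V" "w \<in> carrier V" "v \<oplus>\<^bsub>V\<^esub> w \<in> carrier V" for u v w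
    using hom_mult[OF B[OF that(1)], of v w] that by (simp add: self_module_def)
  have fc: "ext_form R \<beta> n b z \<in> carrier R" if "\<And>i. i < n \<Longrightarrow> z i \<in> carrier V" for z
    unfolding ext_form_def by (rule finsum_closed) (use that mem closed in auto)
  show "phase_pairing R \<epsilon> \<beta> n b x \<noteq> 0"
    using hom_in_carrier[OF \<epsilon>, of "ext_form R \<beta> n b x"] fc[of x] mem
    by (simp add: phase_pairing_def complex_units_def)
  show "phase_pairing R \<epsilon> \<beta> n b (x \<oplus>\<^bsub>N\<^esub> y) = phase_pairing R \<epsilon> \<beta> n b x * phase_pairing R \<epsilon> \<beta> n b y"
  proof -
    interpret V: module R V by fact
    have "ext_form R \<beta> n b (x \<oplus>\<^bsub>N\<^esub> y) = (\<Oplus>\<^bsub>R\<^esub>i\<in>{..<n}. \<beta> (b i) (x i) \<oplus>\<^bsub>R\<^esub> \<beta> (b i) (y i))"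
      unfolding ext_form_def
      by (rule finsum_cong') (use mem closed add in \<open>auto simp: N direct_power_def\<close>)
    also have "\<dots> = ext_form R \<beta> n b x \<oplus>\<^bsub>R\<^esub> ext_form R \<beta> n b y"
      unfolding ext_form_def by (rule finsum_addf) (use mem closed in auto)
    finally show ?thesis
      using hom_mult[OF \<epsilon>, of "ext_form R \<beta> n b x" "ext_form R \<beta> n b y"] fc[of x] fc[of y] mem
      by (simp add: phase_pairing_def complex_units_def)
  qed
qed

lemma shift_op_Bij:
  fixes N :: "('r, 'w, 'm) module_scheme"
  assumes "abelian_group N" and a: "a \<in> carrier N"
  shows "shift_op N a \<in> Bij (fun_space N)"
proof -
  interpret N: abelian_group N by fact
  have e: "f \<in> extensional (carrier N)" if "f \<in> fun_space N" for f :: "'w \<Rightarrow> complex"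
    using that by (auto simp: fun_space_def PiE_def)
  have "bij_betw (shift_op N a) (fun_space N) (fun_space N)"
  proof (rule bij_betw_byWitness[where f' = "shift_op N (\<ominus>\<^bsub>N\<^esub> a)"])
    show "\<forall>f\<in>fun_space N. shift_op N (\<ominus>\<^bsub>N\<^esub> a) (shift_op N a f) = f"
      using a e by (auto simp: shift_op_def fun_space_def N.minus_eq N.a_assoc N.l_neg N.r_neg
          intro!: extensionalityI[of _ "carrier N"])
    show "\<forall>f\<in>fun_space N. shift_op N a (shift_op N (\<ominus>\<^bsub>N\<^esub> a) f) = f"
      using a e by (auto simp: shift_op_def fun_space_def N.minus_eq N.a_assoc N.l_neg N.r_neg
          intro!: extensionalityI[of _ "carrier N"])
  qed (auto simp: shift_op_def fun_space_def)
  then show ?thesis by (auto simp: Bij_def shift_op_def)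
qed

lemma phase_op_Bij:
  fixes N :: "('r, 'w, 'm) module_scheme"
  assumes p: "\<And>x. x \<in> carrier N \<Longrightarrow> p b x \<noteq> 0"
  shows "phase_op N p b \<in> Bij (fun_space N)"
proof -
  have e: "f \<in> extensional (carrier N)" if "f \<in> fun_space N" for f :: "'w \<Rightarrow> complex"
    using that by (auto simp: fun_space_def PiE_def)
  have "bij_betw (phase_op N p b) (fun_space N) (fun_space N)"
    by (rule bij_betw_byWitness[where f' = "phase_op N (\<lambda>b x. inverse (p b x)) b"])
      (use p e in \<open>auto simp: phase_op_def fun_space_def intro!: extensionalityI[of _ "carrier N"]\<close>)
  then show ?thesis by (auto simp: Bij_def phase_op_def)
qed

text \<open>
  The set in \<open>operator_group\<close> is a group of bijections, and on commuting data the generated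
  subgroup is the product of the two subgroups.
\<close>

lemma
  fixes R :: "('r, 'm) ring_scheme" and n k :: nat
  defines "N \<equiv> direct_power (free_module R k) n"
  assumes R: "frobenius_ring R \<epsilon>" and \<beta>: "bilinear_form R (free_module R k) \<beta>"
  defines "p \<equiv> phase_pairing R \<epsilon> \<beta> n"
  shows group_operator_group: "group (operator_group N p)"
    and subgroup_S_subgroup:
      "\<lbrakk>A \<subseteq> carrier N; B \<subseteq> carrier N\<rbrakk> \<Longrightarrow> subgroup (S_subgroup N p A B) (operator_group N p)"
    and S_subgroup_eq_product:
      "\<lbrakk>A \<subseteq> carrier N; B \<subseteq> carrier N; \<forall>a\<in>A. \<forall>b\<in>B. p b a = 1\<rbrakk> \<Longrightarrow>
        S_subgroup N p A B = generate (operator_group N p) (shift_op N ` A)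
          <#>\<^bsub>operator_group N p\<^esub> generate (operator_group N p) (phase_op N p ` B)"
proof -
  have V: "module R (free_module R k)"
    using R by (intro module_free) (simp add: frobenius_ring_def)
  interpret N: module R N
    unfolding N_def by (intro module_direct_power V)
  have abN: "abelian_group N" by (rule N.abelian_group_axioms)
  let ?F = "fun_space N"
  let ?U = "shift_op N ` carrier N \<union> phase_op N p ` carrier N"
  interpret B: group "BijGroup ?F" by (rule group_BijGroup)
  note padd = phase_pairing_add_right(1)[OF R \<beta> V N_def[THEN meta_eq_to_obj_eq], folded p_def]
  note pnz = phase_pairing_add_right(2)[OF R \<beta> V N_def[THEN meta_eq_to_obj_eq], folded p_def]
  have sh: "shift_op N a \<in> Bij ?F" if "a \<in> carrier N" for a
    by (rule shift_op_Bij[OF abN that])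
  have ph: "phase_op N p b \<in> Bij ?F" if "b \<in> carrier N" for b
    by (rule phase_op_Bij) (use pnz that in auto)
  have U: "?U \<subseteq> carrier (BijGroup ?F)"
    using sh ph by (auto simp: BijGroup_def)
  show G: "group (operator_group N p)"
    unfolding operator_group_def
    by (rule subgroup.subgroup_is_group[OF B.generate_is_subgroup[OF U] B.group_axioms])
  interpret G: group "operator_group N p" by (rule G)
  have UG: "?U \<subseteq> carrier (operator_group N p)"
    by (auto simp: operator_group_def intro: generate.incl)
  show "subgroup (S_subgroup N p A B) (operator_group N p)"
    if "A \<subseteq> carrier N" "B \<subseteq> carrier N"
    unfolding S_subgroup_def by (rule G.generate_is_subgroup) (use that UG in blast)
  show "S_subgroup N p A B = generate (operator_group N p) (shift_op N ` A)
          <#>\<^bsub>operator_group N p\<^esub> generate (operator_group N p) (phase_op N p ` B)"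
    if A: "A \<subseteq> carrier N" and B: "B \<subseteq> carrier N" and one: "\<forall>a\<in>A. \<forall>b\<in>B. p b a = 1"
    unfolding S_subgroup_def
  proof (rule G.generate_Un_commuting)
    fix s t assume "s \<in> shift_op N ` A" "t \<in> phase_op N p ` B"
    then obtain a b where ab: "s = shift_op N a" "t = phase_op N p b" "a \<in> A" "b \<in> B"
      by auto
    then have c: "a \<in> carrier N" "b \<in> carrier N" using A B by auto
    have "p b (x \<ominus>\<^bsub>N\<^esub> a) = p b x" if "x \<in> carrier N" for x
      using padd[of b "x \<ominus>\<^bsub>N\<^esub> a" a] c that one ab
      by (simp add: N.minus_eq N.M.a_assoc N.M.l_neg)
    then have "compose ?F s t = compose ?F t s"
      using c by (auto simp: ab compose_def shift_op_def phase_op_def fun_space_def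
          intro!: restrict_ext)
    then show "s \<otimes>\<^bsub>operator_group N p\<^esub> t = t \<otimes>\<^bsub>operator_group N p\<^esub> s"
      using sh ph c by (simp add: ab operator_group_def BijGroup_def)
  qed (use A B UG in blast)+
qed

end

theory Submission
  imports Defs
begin

text \<open>A generated subgroup is abelian exactly when its generators commute pairwise
  (\<open>comm_group_generate_iff\<close>). Two shifts commute because addition in \<open>N\<close>
  does (\<open>shift_op_commute\<close>), and two phases commute because both multiply pointwise by
  scalars (\<open>phase_op_commute\<close>), so only the mixed pairs impose a condition. With
  \<open>p\<close> the phase pairing, shift after phase sends \<open>f\<close> to the function with
  value \<open>p b (x - a) * f (x - a)\<close> at \<open>x\<close>, and phase after shift gives
  \<open>p b x * f (x - a)\<close>. Since \<open>p b\<close> is an additive character of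
  \<open>N\<close>, these agree for all \<open>f\<close> and \<open>x\<close> exactly when
  \<open>p b a = 1\<close> (\<open>shift_phase_commute_iff\<close>).\<close>

text \<open>The centralizer of \<open>c\<close> is a subgroup, so it contains everything generated
  by a subset of it.\<close>

lemma (in group) centralizes_generate:
  assumes X: "X \<subseteq> carrier G" and c: "c \<in> carrier G"
    and comm: "\<And>x. x \<in> X \<Longrightarrow> x \<otimes> c = c \<otimes> x"
    and x: "x \<in> generate G X"
  shows "x \<otimes> c = c \<otimes> x"
  using x
proof (induction rule: generate.induct)
  case (inv h)
  then have "h \<in> carrier G" "h \<otimes> c = c \<otimes> h"
    using X comm by auto
  then show ?case
    using c by (metis inv_closed inv_solve_left inv_solve_right m_assoc m_closed)
next
  case (eng h1 h2)
  then have "h1 \<in> carrier G" "h2 \<in> carrier G"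
    using generate_in_carrier[OF X] by blast+
  then show ?case
    using eng.IH c by (metis m_assoc)
qed (use c comm in auto)

lemma (in group) comm_group_generate_iff:
  assumes X: "X \<subseteq> carrier G"
  shows "comm_group (G\<lparr>carrier := generate G X\<rparr>) \<longleftrightarrow> (\<forall>x\<in>X. \<forall>y\<in>X. x \<otimes> y = y \<otimes> x)"
proof
  assume "comm_group (G\<lparr>carrier := generate G X\<rparr>)"
  then interpret C: comm_group "G\<lparr>carrier := generate G X\<rparr>" .
  show "\<forall>x\<in>X. \<forall>y\<in>X. x \<otimes> y = y \<otimes> x"
    using C.m_comm by (auto intro: generate.incl)
next
  assume comm: "\<forall>x\<in>X. \<forall>y\<in>X. x \<otimes> y = y \<otimes> x"
  have "group (G\<lparr>carrier := generate G X\<rparr>)"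
    by (rule subgroup.subgroup_is_group[OF generate_is_subgroup[OF X] group_axioms])
  moreover have "x \<otimes> y = y \<otimes> x" if x: "x \<in> generate G X" and y: "y \<in> generate G X" for x y
  \<comment> \<open>The centralizer argument is used twice: each generator \<open>z\<close> commutes
    with all of the generated subgroup, in particular with \<open>y\<close>; hence \<open>y\<close>
    commutes with every generator, and so with \<open>x\<close>.\<close>
  proof (rule centralizes_generate[OF X _ _ x])
    show "y \<in> carrier G"
      using generate_in_carrier[OF X y] .
    show "z \<otimes> y = y \<otimes> z" if "z \<in> X" for z
      using centralizes_generate[OF X _ _ y, of z] that comm X by auto
  qed
  ultimately show "comm_group (G\<lparr>carrier := generate G X\<rparr>)"
    by (intro group.group_comm_groupI) auto
qed

lemma shift_op_commute:
  fixes N :: "('r, 'w, 'm) module_scheme"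
  assumes "abelian_group N" and a: "a \<in> carrier N" and b: "b \<in> carrier N"
  shows "compose (fun_space N) (shift_op N a) (shift_op N b)
       = compose (fun_space N) (shift_op N b) (shift_op N a)"
proof -
  interpret N: abelian_group N by fact
  have "x \<ominus>\<^bsub>N\<^esub> a \<ominus>\<^bsub>N\<^esub> b = x \<ominus>\<^bsub>N\<^esub> b \<ominus>\<^bsub>N\<^esub> a" if "x \<in> carrier N" for x
    using a b that by (simp add: N.minus_eq N.a_ac)
  then show ?thesis
    using a b by (auto simp: compose_def shift_op_def fun_space_def intro!: restrict_ext)
qed

lemma phase_op_commute:
  "compose (fun_space N) (phase_op N p b) (phase_op N p c)
     = compose (fun_space N) (phase_op N p c) (phase_op N p b)"
  by (auto simp: compose_def phase_op_def fun_space_def intro!: restrict_ext)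

text \<open>The hypotheses \<open>add\<close> and \<open>nz\<close> make \<open>p b\<close> a
  character of the additive group of \<open>N\<close>. Moving the shift past the phase operator
  therefore costs exactly the scalar \<open>p b a\<close>.\<close>

lemma shift_phase_commute_iff:
  fixes N :: "('r, 'w, 'm) module_scheme"
  assumes "abelian_group N" and a: "a \<in> carrier N"
    and add: "\<And>x y. x \<in> carrier N \<Longrightarrow> y \<in> carrier N \<Longrightarrow> p b (x \<oplus>\<^bsub>N\<^esub> y) = p b x * p b y"
    and nz: "\<And>x. x \<in> carrier N \<Longrightarrow> p b x \<noteq> 0"
  shows "compose (fun_space N) (shift_op N a) (phase_op N p b)
       = compose (fun_space N) (phase_op N p b) (shift_op N a) \<longleftrightarrow> p b a = 1"
    (is "?l = ?r \<longleftrightarrow> _")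
proof
  interpret N: abelian_group N by fact
  assume eq: "?l = ?r"
  \<comment> \<open>Evaluate both sides on the constant function 1 at the point \<open>a\<close>.\<close>
  let ?f = "\<lambda>x\<in>carrier N. 1 :: complex"
  \<comment> \<open>A nonzero idempotent complex number is 1; this is the value of the left side,
    since the shift moves the point \<open>a\<close> to zero.\<close>
  have "p b \<zero>\<^bsub>N\<^esub> * p b \<zero>\<^bsub>N\<^esub> = p b \<zero>\<^bsub>N\<^esub>"
    using add[of "\<zero>\<^bsub>N\<^esub>" "\<zero>\<^bsub>N\<^esub>"] by simp
  then have "p b \<zero>\<^bsub>N\<^esub> = 1"
    using nz[of "\<zero>\<^bsub>N\<^esub>"] by simp
  moreover have "?l ?f a = p b \<zero>\<^bsub>N\<^esub>" "?r ?f a = p b a"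
    using a by (auto simp: compose_def shift_op_def phase_op_def fun_space_def
        N.minus_eq N.r_neg)
  ultimately show "p b a = 1"
    using eq by simp
next
  interpret N: abelian_group N by fact
  assume "p b a = 1"
  \<comment> \<open>Additivity is applied to the splitting of \<open>x\<close> as
    \<open>(x - a) + a\<close>.\<close>
  then have "p b (x \<ominus>\<^bsub>N\<^esub> a) = p b x" if "x \<in> carrier N" for x
    using add[of "x \<ominus>\<^bsub>N\<^esub> a" a] a that by (simp add: N.minus_eq N.a_assoc N.l_neg)
  then show "?l = ?r"
    using a by (auto simp: compose_def shift_op_def phase_op_def fun_space_def
        intro!: restrict_ext)
qed

theorem proposition5p2:
  fixes R :: "('r, 'm) ring_scheme" and \<epsilon> :: "'r \<Rightarrow> complex"
    and k n :: nat
    and V :: "('r, nat \<Rightarrow> 'r) module" and \<beta> :: "(nat \<Rightarrow> 'r) \<Rightarrow> (nat \<Rightarrow> 'r) \<Rightarrow> 'r"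
    and N :: "('r, nat \<Rightarrow> nat \<Rightarrow> 'r) module" and A B :: "(nat \<Rightarrow> nat \<Rightarrow> 'r) set"
  assumes "frobenius_ring R \<epsilon>"
    and "V = free_module R k"
    and "perfect_form R V \<beta>"
    and "n \<ge> 1"
    and "N = direct_power V n"
    and "submodule A R N" and "submodule B R N"
  shows "(comm_group ((operator_group N (phase_pairing R \<epsilon> \<beta> n))
            \<lparr>carrier := S_subgroup N (phase_pairing R \<epsilon> \<beta> n) A B\<rparr>)
          \<longleftrightarrow> (\<forall>a\<in>A. \<forall>b\<in>B. \<epsilon> (ext_form R \<beta> n b a) = 1))
       \<and> (comm_group ((operator_group N (phase_pairing R \<epsilon> \<beta> n))
            \<lparr>carrier := S_subgroup N (phase_pairing R \<epsilon> \<beta> n) A B\<rparr>)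
          \<longleftrightarrow> B \<subseteq> perp N (phase_pairing R \<epsilon> \<beta> n) A)"
proof -
  let ?p = "phase_pairing R \<epsilon> \<beta> n"
  let ?G = "operator_group N ?p"
  let ?F = "fun_space N"
  have \<beta>: "bilinear_form R (free_module R k) \<beta>"
    using assms(2,3) by (simp add: perfect_form_def)
  have N: "N = direct_power (free_module R k) n"
    using assms(2,5) by simp
  have V: "module R (free_module R k)"
    using assms(1) by (intro module_free) (simp add: frobenius_ring_def)
  interpret N: module R N
    unfolding N by (intro module_direct_power V)
  interpret G: group ?G
    unfolding N by (rule group_operator_group[OF assms(1) \<beta>])
  note add = phase_pairing_add_right(1)[OF assms(1) \<beta> V N]
  note nz = phase_pairing_add_right(2)[OF assms(1) \<beta> V N]
  have A: "A \<subseteq> carrier N" and B: "B \<subseteq> carrier N"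
    using assms(6,7) subgroup.subset unfolding submodule_def by fastforce+
  have shG: "shift_op N ` A \<subseteq> carrier ?G" and phG: "phase_op N ?p ` B \<subseteq> carrier ?G"
    using A B by (auto simp: operator_group_def intro!: generate.incl)
  have sh: "shift_op N a \<in> Bij ?F" if "a \<in> A" for a
    using shift_op_Bij[OF N.abelian_group_axioms] A that by blast
  have ph: "phase_op N ?p b \<in> Bij ?F" if "b \<in> B" for b
    by (rule phase_op_Bij) (use nz B that in auto)
  \<comment> \<open>Multiplication in \<open>BijGroup\<close> is restricted to bijections, so it
    unfolds to composition only once \<open>sh\<close> and \<open>ph\<close> are available.\<close>
  have mult: "s \<otimes>\<^bsub>?G\<^esub> t = compose ?F s t" if "s \<in> Bij ?F" "t \<in> Bij ?F" for s t
    using that by (simp add: operator_group_def BijGroup_def)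
  have "comm_group (?G\<lparr>carrier := S_subgroup N ?p A B\<rparr>) \<longleftrightarrow>
    (\<forall>s\<in>shift_op N ` A \<union> phase_op N ?p ` B. \<forall>t\<in>shift_op N ` A \<union> phase_op N ?p ` B.
      s \<otimes>\<^bsub>?G\<^esub> t = t \<otimes>\<^bsub>?G\<^esub> s)"
    unfolding S_subgroup_def by (rule G.comm_group_generate_iff) (use shG phG in blast)
  \<comment> \<open>Pairs of the same kind always commute, and the two orders of a mixed pair give
    the same equation.\<close>
  also have "\<dots> \<longleftrightarrow> (\<forall>a\<in>A. \<forall>b\<in>B.
      shift_op N a \<otimes>\<^bsub>?G\<^esub> phase_op N ?p b = phase_op N ?p b \<otimes>\<^bsub>?G\<^esub> shift_op N a)"
  proof -
    have "shift_op N a \<otimes>\<^bsub>?G\<^esub> shift_op N b = shift_op N b \<otimes>\<^bsub>?G\<^esub> shift_op N a"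
      if "a \<in> A" "b \<in> A" for a b
      using shift_op_commute[OF N.abelian_group_axioms] A that sh by (auto simp: mult)
    moreover have "phase_op N ?p b \<otimes>\<^bsub>?G\<^esub> phase_op N ?p c = phase_op N ?p c \<otimes>\<^bsub>?G\<^esub> phase_op N ?p b"
      if "b \<in> B" "c \<in> B" for b c
      using phase_op_commute that ph by (auto simp: mult)
    ultimately show ?thesis
      by (auto simp: ball_Un)
  qed
  also have "\<dots> \<longleftrightarrow> (\<forall>a\<in>A. \<forall>b\<in>B. ?p b a = 1)"
  proof (intro ball_cong refl)
    fix a b assume ab: "a \<in> A" "b \<in> B"
    then show "(shift_op N a \<otimes>\<^bsub>?G\<^esub> phase_op N ?p b = phase_op N ?p b \<otimes>\<^bsub>?G\<^esub> shift_op N a)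
        \<longleftrightarrow> ?p b a = 1"
      unfolding mult[OF sh ph, OF ab] mult[OF ph sh, OF ab(2,1)]
      using A B by (intro shift_phase_commute_iff N.abelian_group_axioms add nz) auto
  qed
  \<comment> \<open>Both conjuncts are this one condition: \<open>perp\<close> puts its own element
    in the first argument of the pairing, matching \<open>?p b a\<close>, and membership in
    \<open>carrier N\<close> comes from \<open>B\<close>.\<close>
  finally show ?thesis
    using B by (auto simp: perp_def phase_pairing_def)
qed

end
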